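(* Let $\Sigma$ be an alphabet of size $\sigma \ge 2$, let $T$ be an ordered rooted tree with $n_T$ nodes, each labelled with a symbol of $\Sigma$, let $\mathcal{T}$ be the (labelled) top tree of $T$ and let $\mathcal{TD}$ be its top DAG, of total size $n_{TD}$ (number of nodes plus number of edges). Then $$n_{TD} = O\!\left(\frac{n_T}{\log_\sigma n_T}\cdot \log\log_\sigma n_T\right).$$
   Context: Top tree construction (Bille, Gørtz, Landau, Weimann). Let $T$ be an ordered rooted labelled tree. We maintain an auxiliary ordered rooted tree $T_j$ (initially $T_0=T$) in which every edge $e$ is associated with a node $C(e)$ (a "cluster") of a binary forest under construction. Initially, for every edge $(u,v)$ of $T$ with $v$ a child of $u$, a leaf cluster is created and labelled with the label of the child endpoint $v$ (only this label is stored). Iteration $j$ builds $T_{j+1}$ from $T_j$ by the following two steps; every edge of $T_j$ takes part in at most one merge per iteration. Step 1 (horizontal merges): for each node $v$ of $T_j$ with $k\ge 2$ children $v_1,\dots,v_k$ (in order), for $i=1,\dots,\lfloor k/2\rfloor$ merge the edges $(v,v_{2i-1})$ and $(v,v_{2i})$ if $v_{2i-1}$ or $v_{2i}$ is a leaf of $T_j$; if $k$ is odd, $v_k$ is a leaf and both $v_{k-2},v_{k-1}$ are non-leaves, also merge $(v,v_{k-1})$ and $(v,v_k)$. Merging $(v,x)$ and $(v,y)$, with $x$ the earlier sibling, creates a new cluster with left child $C((v,x))$ and right child $C((v,y))$, labelled with merge type (c) if $x$ is a non-leaf, (d) if $y$ is a non-leaf, (e) if both are leaves; in the tree the two edges are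 replaced (at the position of the first) by one edge from $v$ to the non-leaf among $x,y$ (keeping its subtree), or to a leaf if both are leaves. Step 2 (vertical merges): for each maximal path $v_1,\dots,v_p$ of nodes of $T_j$ such that $v_{i+1}$ is the parent of $v_i$ and $v_2,\dots,v_{p-1}$ each have exactly one child, write $e_i=(v_i,v_{i+1})$. If $p$ is even, merge the pairs $\{e_1,e_2\},\{e_3,e_4\},\dots,\{e_{p-3},e_{p-2}\}$; if $p$ is odd, merge $\{e_1,e_2\},\dots,\{e_{p-4},e_{p-3}\}$ and, if $e_{p-1}$ was not merged in Step 1, also $\{e_{p-2},e_{p-1}\}$. Merging a lower edge $(a,b)$ with the upper edge $(b,c)$ (where $b$ has the single child $a$) creates a cluster with left child $C((b,c))$ and right child $C((a,b))$, labelled with merge type (a) if $a$ is a non-leaf of $T_j$ and (b) if $a$ is a leaf; in the tree, $b$ is removed and the two edges are replaced by the single edge $(a,c)$ at the position of $(b,c)$. Iterations are repeated until a single edge remains. Finally a dummy leaf cluster labelled with the label of the root of $T$ (representing a dummy edge entering the root) is merged, as left child and with merge type (a), with the cluster of the last remaining edge; the result is the root of the top tree $\mathcal{T}$. Thus $\mathcal{T}$ is an ordered full binary tree whose leaves are labelled with symbols of $\Sigma$ and whose inner nodes are labelled with one of five merge types (a)–(e). The top DAG $\mathcal{TD}$ is the minimal DAG of $\mathcal{T}$, obtained by representing every set of identical (equal as ordered labelled trees) subtrees of $\mathcal{T}$ by a single shared node; its size $n_{TD}$ is its number of nodes plus edges. *)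

theory Defs
  imports Complex_Main "HOL-Library.While_Combinator"
begin

datatype 'a otree = ONode (label: 'a) (children: "'a otree list")

primrec num_nodes :: "'a otree \<Rightarrow> nat" where
  "num_nodes (ONode a ts) = Suc (sum_list (map num_nodes ts))"

datatype merge_type = MA | MB | MC | MD | ME

datatype 'a cluster = CLeaf 'a | CMerge merge_type "'a cluster" "'a cluster"

text \<open>The auxiliary trees \<open>T\<^sub>j\<close>. A node is the ordered list of its outgoing edges, each edge
  carrying an annotation (its cluster) and leading to a child. The node labels of \<open>T\<close> enter only
  through the initial leaf clusters.\<close>

datatype 'e aux_tree = Aux (edges: "('e \<times> 'e aux_tree) list")

abbreviation is_leaf :: "'e aux_tree \<Rightarrow> bool" where
  "is_leaf t \<equiv> edges t = []"

fun initial :: "'a otree \<Rightarrow> 'a cluster aux_tree" where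
  "initial (ONode a ts) =
     Aux (map (\<lambda>t. (CLeaf (label t), initial t)) ts)"

text \<open>Step 1. In its result every edge carries, besides its cluster, a flag telling whether it was
  created by a horizontal merge.\<close>

fun hmerge_edges ::
  "'a cluster \<times> 'e aux_tree \<Rightarrow> 'a cluster \<times> 'e aux_tree \<Rightarrow> ('a cluster \<times> bool) \<times> 'e aux_tree" where
  "hmerge_edges (c, x) (d, y) =
     (if \<not> is_leaf x then ((CMerge MC c d, True), x)
      else if \<not> is_leaf y then ((CMerge MD c d, True), y)
      else ((CMerge ME c d, True), x))"

fun keep_edge :: "'a cluster \<times> 'e aux_tree \<Rightarrow> ('a cluster \<times> bool) \<times> 'e aux_tree" where
  "keep_edge (c, x) = ((c, False), x)"

definition hpair ::
  "'a cluster \<times> 'e aux_tree \<Rightarrow> 'a cluster \<times> 'e aux_tree \<Rightarrow> (('a cluster \<times> bool) \<times> 'e aux_tree) list" where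
  "hpair e f =
     (if is_leaf (snd e) \<or> is_leaf (snd f) then [hmerge_edges e f] else [keep_edge e, keep_edge f])"

text \<open>The edges are consumed from the left in pairs, so the three-element case below is reached
  exactly when the number \<open>k \<ge> 3\<close> of children is odd, with the last three edges.\<close>

fun hmerge :: "('a cluster \<times> 'e aux_tree) list \<Rightarrow> (('a cluster \<times> bool) \<times> 'e aux_tree) list" where
  "hmerge [] = []"
| "hmerge [e] = [keep_edge e]"
| "hmerge [e, f, g] =
     (if \<not> is_leaf (snd e) \<and> \<not> is_leaf (snd f) \<and> is_leaf (snd g)
      then [keep_edge e, hmerge_edges f g]
      else hpair e f @ [keep_edge g])"
| "hmerge (e # f # es) = hpair e f @ hmerge es"

text \<open>Horizontal merges never turn a leaf into a non-leaf or conversely, so testing the already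
  processed children for being leaves is the same as testing the children in \<open>T\<^sub>j\<close>.\<close>

primrec horizontal :: "'a cluster aux_tree \<Rightarrow> ('a cluster \<times> bool) aux_tree" where
  "horizontal (Aux es) = Aux (hmerge (map (map_prod id horizontal) es))"

text \<open>Step 2. A node has exactly one child in \<open>T\<^sub>j\<close> iff after Step 1 it has exactly one outgoing edge
  and that edge is not flagged as merged. For a node \<open>v\<close>, \<open>path_below\<close> follows these unary nodes
  downwards from \<open>v\<close> as long as possible, and returns the clusters of the edges passed (top to
  bottom) and the final node, which is a leaf or has at least two children in \<open>T\<^sub>j\<close>.\<close>

fun path_below :: "('c \<times> bool) aux_tree \<Rightarrow> 'c list \<times> ('c \<times> bool) aux_tree" where
  "path_below (Aux [((c, False), t)]) = (let (cs, b) = path_below t in (c # cs, b))"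
| "path_below t = ([], t)"

lemma size_path_below: "path_below t = (cs, b) \<Longrightarrow> size b \<le> size t"
  by (induction t arbitrary: cs b rule: path_below.induct)
     (force split: prod.splits)+

text \<open>Merges consecutive pairs of edges of a path; the clusters are listed from top to bottom, and
  \<open>lf\<close> tells whether the bottom node of the path is a leaf.\<close>

fun vpairs :: "bool \<Rightarrow> 'a cluster list \<Rightarrow> 'a cluster list" where
  "vpairs lf (u # l # cs) =
     CMerge (if cs = [] \<and> lf then MB else MA) u l # vpairs lf cs"
| "vpairs lf cs = cs"

text \<open>For a maximal path \<open>v\<^sub>1, \<dots>, v\<^sub>p\<close>: \<open>c\<close> and \<open>m\<close> are the cluster and the flag of its
  top edge \<open>e\<^bsub>p-1\<^esub>\<close>, and \<open>cs\<close> lists the clusters of \<open>e\<^bsub>p-2\<^esub>, \<dots>, e\<^sub>1\<close>, so that \<open>p = length cs + 2\<close>.\<close>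

fun vmerge :: "bool \<Rightarrow> 'a cluster \<times> bool \<Rightarrow> 'a cluster list \<Rightarrow> 'a cluster list" where
  "vmerge lf (c, m) cs =
     (if even (length cs) then c # vpairs lf cs
      else if m then c # hd cs # vpairs lf (tl cs)
      else vpairs lf (c # cs))"

fun build_path :: "'c list \<Rightarrow> 'c aux_tree \<Rightarrow> 'c aux_tree" where
  "build_path [] b = b"
| "build_path (c # cs) b = Aux [(c, build_path cs b)]"

text \<open>\<open>vertical\<close> is only ever applied to the upper end of maximal paths (the root or a node that is
  not unary in \<open>T\<^sub>j\<close>) and to leaves.\<close>

function vertical :: "('a cluster \<times> bool) aux_tree \<Rightarrow> 'a cluster aux_tree" where
  "vertical (Aux es) =
     Aux (map (\<lambda>(e, t).
       (case path_below t of (cs, b) \<Rightarrow>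
         (case vmerge (is_leaf b) e cs of d # ds \<Rightarrow> (d, build_path ds (vertical b))))) es)"
  by pat_completeness auto
termination
  by (relation "measure size")
     (auto simp: less_Suc_eq_le intro!: size_list_estimation' le_SucI
           dest!: size_path_below[OF sym])

definition iteration :: "'a cluster aux_tree \<Rightarrow> 'a cluster aux_tree" where
  "iteration t = vertical (horizontal t)"

definition single_edge :: "'e aux_tree \<Rightarrow> bool" where
  "single_edge t \<longleftrightarrow> (\<exists>c. t = Aux [(c, Aux [])])"

text \<open>Meaningful for trees with at least one edge.\<close>

definition top_tree :: "'a otree \<Rightarrow> 'a cluster" where
  "top_tree T =
     CMerge MA (CLeaf (label T))
       (fst (hd (edges (while (\<lambda>t. \<not> single_edge t) iteration (initial T)))))"

primrec subtrees :: "'a cluster \<Rightarrow> 'a cluster set" where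
  "subtrees (CLeaf a) = {CLeaf a}"
| "subtrees (CMerge m l r) = insert (CMerge m l r) (subtrees l \<union> subtrees r)"

text \<open>The minimal DAG: its nodes are the distinct subtrees. An edge also records whether it leads to
  the left (\<open>False\<close>) or right (\<open>True\<close>) child, so an inner node with two identical children still has
  two outgoing edges.\<close>

definition dag_nodes :: "'a cluster \<Rightarrow> 'a cluster set" where
  "dag_nodes t = subtrees t"

definition dag_edges :: "'a cluster \<Rightarrow> ('a cluster \<times> bool \<times> 'a cluster) set" where
  "dag_edges t =
     {(CMerge m l r, False, l) | m l r. CMerge m l r \<in> subtrees t} \<union>
     {(CMerge m l r, True, r) | m l r. CMerge m l r \<in> subtrees t}"

definition top_dag_size :: "'a otree \<Rightarrow> nat" where
  "top_dag_size T = card (dag_nodes (top_tree T)) + card (dag_edges (top_tree T))"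

end

theory Submission
  imports Defs "HOL-Library.Multiset"
begin

text \<open>
  An iteration shrinks the number of edges by a factor of at least \<open>8/9\<close>: the leaves can be charged
  to merges, and a tree with few leaves consists mostly of long unary paths, half of whose edges
  disappear. So \<open>T\<^sub>j\<close> has at most \<open>(8/9)\<^sup>j n\<close> edges, while the leaf counts of the clusters on its
  edges always add up to \<open>n - 1\<close>. Put \<open>L = log\<^sub>\<sigma> n\<close> and call a cluster large if it has more than
  \<open>L/12\<close> leaves. Each iteration contributes \<open>O(n/L)\<close> large clusters, and the iterations after the
  first \<open>O(log L)\<close> contribute only \<open>O(n/L)\<close> clusters altogether, which gives \<open>O(n/L log L)\<close> large
  clusters. Distinct small clusters have distinct preorder words of length less than \<open>L/6\<close> over
  \<open>\<sigma> + 5 \<le> \<sigma>\<^sup>3\<close> symbols, so there are at most \<open>\<surd>n\<close> of them.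
\<close>

section \<open>Multisets, sums and logarithms\<close>

lemma image_mset_sum_list: "image_mset f (\<Sum>x\<leftarrow>xs. g x) = (\<Sum>x\<leftarrow>xs. image_mset f (g x))"
  by (induction xs) auto

lemma card_set_mset_le_size: "card (set_mset A) \<le> size A"
  using size_mset_mono[OF mset_set_set_mset_msubset[of A]] by simp

lemma card_greater_mult_le_sum_mset:
  fixes f :: "'b \<Rightarrow> nat"
  shows "card {x \<in> set_mset A. s < f x} * Suc s \<le> (\<Sum>x\<in>#A. f x)"
proof -
  let ?A = "filter_mset (\<lambda>x. s < f x) A"
  have "card {x \<in> set_mset A. s < f x} * Suc s \<le> size ?A * Suc s"
    using card_set_mset_le_size[of ?A] by (intro mult_le_mono1) simp
  also have "\<dots> \<le> (\<Sum>x\<in>#A. f x)" by (induction A) auto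
  finally show ?thesis .
qed

lemma sum_powers_le_power:
  fixes k :: nat
  assumes "k \<ge> 2"
  shows "(\<Sum>i<n. k ^ i) \<le> k ^ n"
proof (induction n)
  case (Suc n)
  then have "(\<Sum>i<Suc n. k ^ i) \<le> 2 * k ^ n" by simp
  also have "\<dots> \<le> k ^ Suc n" using assms by simp
  finally show ?case .
qed simp

lemma finite_lists_length_less: "finite A \<Longrightarrow> finite {xs. set xs \<subseteq> A \<and> length xs < n}"
  by (rule finite_subset[OF _ finite_lists_length_le[of A n]]) auto

lemma card_lists_length_less_le:
  assumes "finite A" "card A \<ge> 2"
  shows "card {xs. set xs \<subseteq> A \<and> length xs < n} \<le> card A ^ n"
proof -
  have "card {xs. set xs \<subseteq> A \<and> length xs < n} = (\<Sum>i<n. card A ^ i)"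
    using card_lists_length_le[OF assms(1)]
    by (cases n) (simp_all add: less_Suc_eq_le lessThan_Suc_atMost)
  then show ?thesis using sum_powers_le_power[OF assms(2), of n] by simp
qed

lemma sum_min_power_le:
  fixes a q :: real
  assumes "a \<ge> 0" "0 \<le> q" "q < 1"
  shows "(\<Sum>i<j. min a (q ^ i)) \<le> K * a + q ^ K / (1 - q)"
proof -
  have "(\<Sum>i<j. min a (q ^ i)) \<le> (\<Sum>i<K + j. min a (q ^ i))"
    using assms by (intro sum_mono2) auto
  also have "\<dots> = (\<Sum>i<K. min a (q ^ i)) + (\<Sum>i<j. min a (q ^ (K + i)))"
    by (induction j) simp_all
  also have "\<dots> \<le> (\<Sum>i<K. a) + (\<Sum>i<j. q ^ K * q ^ i)"
    by (intro add_mono sum_mono) (auto simp: power_add)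
  also have "(\<Sum>i<j. q ^ K * q ^ i) = q ^ K * ((1 - q ^ j) / (1 - q))"
    using assms by (simp add: sum_gp_strict flip: sum_distrib_left)
  also have "\<dots> \<le> q ^ K * (1 / (1 - q))"
    using assms by (intro mult_left_mono divide_right_mono) auto
  finally show ?thesis by simp
qed

lemma power_le_inverse:
  fixes q x :: real
  assumes "0 < q" "q < 1" "x > 0" "log (1 / q) x \<le> real k"
  shows "q ^ k \<le> 1 / x"
proof -
  have "x = (1 / q) powr log (1 / q) x" using assms by simp
  also have "\<dots> \<le> (1 / q) powr real k" using assms by (intro powr_mono) auto
  also have "\<dots> = 1 / q ^ k" using assms by (simp add: powr_realpow power_divide)
  finally show ?thesis using assms by (simp add: field_simps)
qed

lemma power_le_sqrt:
  fixes \<sigma> n :: real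
  assumes "\<sigma> > 1" "n > 0" "real (2 * k) \<le> log \<sigma> n"
  shows "\<sigma> ^ k \<le> sqrt n"
proof (rule real_le_rsqrt)
  have "(\<sigma> ^ k)\<^sup>2 = \<sigma> powr real (2 * k)"
    using powr_realpow[of \<sigma> "2 * k"] assms(1) by (simp add: power_even_eq)
  also have "\<dots> \<le> n" using assms by (simp add: le_log_iff)
  finally show "(\<sigma> ^ k)\<^sup>2 \<le> n" .
qed

lemma log_le_4_sqrt:
  fixes \<sigma> n :: real
  assumes "\<sigma> \<ge> 2" "n \<ge> 1"
  shows "log \<sigma> n \<le> 4 * sqrt n"
proof -
  have "1 / 2 \<le> ln (2 :: real)" using ln_le_minus_one[of "1 / 2"] by (simp add: ln_div)
  also have "\<dots> \<le> ln \<sigma>" using assms by simp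
  finally have "1 / 2 \<le> ln \<sigma>" .
  moreover have "ln n \<le> 2 * sqrt n"
    using ln_powr_bound[of n "1 / 2"] assms by (simp add: powr_half_sqrt)
  ultimately have "ln n / ln \<sigma> \<le> 2 * sqrt n / (1 / 2)"
    using assms by (intro frac_le) simp_all
  then show ?thesis by (simp add: log_def)
qed

lemma sqrt_le_div_log:
  fixes \<sigma> n :: real
  assumes "\<sigma> \<ge> 2" "n > 1"
  shows "sqrt n \<le> 4 * (n / log \<sigma> n)"
proof -
  have "sqrt n * log \<sigma> n \<le> sqrt n * (4 * sqrt n)"
    using assms by (intro mult_left_mono log_le_4_sqrt) auto
  also have "\<dots> = 4 * n" using assms by simp
  finally show ?thesis using assms by (simp add: field_simps)
qed

section \<open>Disjoint merges of clusters\<close>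

primrec num_leaves :: "'a cluster \<Rightarrow> nat" where
  "num_leaves (CLeaf a) = 1"
| "num_leaves (CMerge m l r) = num_leaves l + num_leaves r"

inductive disjoint_merges :: "'a cluster multiset \<Rightarrow> 'a cluster multiset \<Rightarrow> bool" where
  empty: "disjoint_merges {#} {#}"
| keep: "disjoint_merges A B \<Longrightarrow> disjoint_merges (add_mset c A) (add_mset c B)"
| merge: "disjoint_merges A B \<Longrightarrow>
    disjoint_merges (add_mset u (add_mset l A)) (add_mset (CMerge m u l) B)"

lemma disjoint_merges_refl: "disjoint_merges A A"
  by (induction A) (auto intro: disjoint_merges.intros)

lemma disjoint_merges_union:
  assumes "disjoint_merges A B" "disjoint_merges A' B'"
  shows "disjoint_merges (A + A') (B + B')"
  using assms by induction (auto intro: disjoint_merges.intros)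

lemma disjoint_merges_sum_list:
  assumes "\<And>x. x \<in> set xs \<Longrightarrow> disjoint_merges (f x) (g x)"
  shows "disjoint_merges (\<Sum>x\<leftarrow>xs. f x) (\<Sum>x\<leftarrow>xs. g x)"
  using assms by (induction xs) (auto intro: disjoint_merges.empty disjoint_merges_union)

lemma sum_num_leaves_disjoint_merges:
  "disjoint_merges A B \<Longrightarrow> (\<Sum>c\<in>#B. num_leaves c) = (\<Sum>c\<in>#A. num_leaves c)"
  by (induction rule: disjoint_merges.induct) auto

lemma size_disjoint_merges_le: "disjoint_merges A B \<Longrightarrow> size B \<le> size A"
  by (induction rule: disjoint_merges.induct) auto

definition subclusters :: "'a cluster multiset \<Rightarrow> 'a cluster set" where
  "subclusters A = (\<Union>c\<in>set_mset A. subtrees c)"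

lemma subclusters_disjoint_merges:
  assumes "disjoint_merges A B"
  shows "subclusters B \<subseteq> set_mset B \<union> subclusters A"
proof -
  have "c \<in> subtrees c" for c :: "'a cluster" by (cases c) auto
  with assms show ?thesis
    by (induction rule: disjoint_merges.induct) (auto simp: subclusters_def)
qed

lemma set_cluster_disjoint_merges:
  "disjoint_merges A B \<Longrightarrow> (\<Union>c\<in>set_mset B. set_cluster c) = (\<Union>c\<in>set_mset A. set_cluster c)"
  by (induction rule: disjoint_merges.induct) auto

section \<open>Annotations of auxiliary trees\<close>

lemma aux_tree_induct [case_names Aux]:
  assumes "\<And>es. (\<And>p. p \<in> set es \<Longrightarrow> P (snd p)) \<Longrightarrow> P (Aux es)"
  shows "P t"
proof (induction t)
  case (Aux es)
  show ?case by (rule assms, rule Aux.IH) auto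
qed

lemma size_snd_less [termination_simp]: "p \<in> set es \<Longrightarrow> size (snd p) < size (Aux es)"
  by (induction es) auto

fun annotations :: "'e aux_tree \<Rightarrow> 'e multiset" where
  "annotations (Aux es) = (\<Sum>p\<leftarrow>es. add_mset (fst p) (annotations (snd p)))"

lemma annotations_Aux_eq_add:
  "annotations (Aux es) = image_mset fst (mset es) + (\<Sum>p\<leftarrow>es. annotations (snd p))"
  by (induction es) auto

abbreviation num_edges :: "'e aux_tree \<Rightarrow> nat" where
  "num_edges t \<equiv> size (annotations t)"

lemma annotations_eq_empty [simp]: "annotations t = {#} \<longleftrightarrow> is_leaf t"
  by (cases t; cases "edges t") auto

lemma single_edge_if_num_edges_eq_1:
  assumes "num_edges t = 1"
  shows "single_edge t"
proof -
  obtain es where t_eq: "t = Aux es" by (cases t)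
  with assms obtain e u es' where es_eq: "es = (e, u) # es'" by (cases es) auto
  have "is_leaf u" "is_leaf (Aux es')"
    using assms by (simp_all add: t_eq es_eq del: aux_tree.sel flip: annotations_eq_empty)
  then show ?thesis by (cases u) (simp add: t_eq es_eq single_edge_def)
qed

primrec node_labels :: "'a otree \<Rightarrow> 'a multiset" where
  "node_labels (ONode a ts) = add_mset a (sum_list (map node_labels ts))"

lemma size_node_labels: "size (node_labels T) = num_nodes T"
proof (induction T)
  case (ONode a ts)
  then show ?case by (induction ts) auto
qed

lemma set_node_labels: "set_mset (node_labels T) = set_otree T"
  by (induction T) auto

lemma annotations_initial:
  "add_mset (CLeaf (label T)) (annotations (initial T)) = image_mset CLeaf (node_labels T)"
proof (induction T)
  case (ONode a ts)
  then show ?case by (induction ts) auto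
qed

section \<open>Horizontal merges\<close>

lemma keep_edge_sel [simp]: "fst (keep_edge e) = (fst e, False)" "snd (keep_edge e) = snd e"
  by (cases e; simp)+

lemma snd_fst_hmerge_edges: "snd (fst (hmerge_edges p q))"
  by (cases p; cases q) simp

lemma hmerge_eq_Nil [simp]: "hmerge es = [] \<longleftrightarrow> es = []"
  by (induction es rule: hmerge.induct) (auto simp: hpair_def)

lemma is_leaf_horizontal [simp]: "is_leaf (horizontal t) \<longleftrightarrow> is_leaf t"
  by (cases t) simp

lemma disjoint_merges_hmerge_edges:
  "disjoint_merges {#fst p, fst q#} {#fst (fst (hmerge_edges p q))#}"
  by (cases p; cases q) (auto intro: disjoint_merges.intros)

lemma disjoint_merges_add_hpair:
  assumes "disjoint_merges A B"
  shows "disjoint_merges (add_mset (fst p) (add_mset (fst q) A))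
    (image_mset (\<lambda>p. fst (fst p)) (mset (hpair p q)) + B)"
  using disjoint_merges_union[OF disjoint_merges_hmerge_edges assms, of p q] assms
  by (simp add: hpair_def disjoint_merges.keep)

lemma disjoint_merges_hmerge:
  "disjoint_merges (image_mset fst (mset es)) (image_mset (\<lambda>p. fst (fst p)) (mset (hmerge es)))"
proof (induction es rule: hmerge.induct)
  case (3 p q r)
  then show ?case
    using disjoint_merges_add_hpair[OF disjoint_merges_refl[of "{#fst r#}"], of p q]
    by (simp add: disjoint_merges.keep disjoint_merges_hmerge_edges)
next
  case ("4_1" p q)
  then show ?case using disjoint_merges_add_hpair[OF disjoint_merges.empty, of p q] by simp
next
  case ("4_2" p q r p' es)
  then show ?case using disjoint_merges_add_hpair[OF "4_2.IH", of p q] by simp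
qed (simp_all add: disjoint_merges_refl)

lemma sum_list_snd_hmerge:
  fixes f :: "'e aux_tree \<Rightarrow> 'b :: comm_monoid_add"
  assumes "\<And>t. is_leaf t \<Longrightarrow> f t = 0"
  shows "(\<Sum>p\<leftarrow>hmerge es. f (snd p)) = (\<Sum>p\<leftarrow>es. f (snd p))"
proof -
  have "f (snd (hmerge_edges p q)) = f (snd p) + f (snd q)"
    if "is_leaf (snd p) \<or> is_leaf (snd q)" for p q :: "'a cluster \<times> 'e aux_tree"
    using that by (cases p; cases q) (auto simp: assms)
  then show ?thesis
    by (induction es rule: hmerge.induct) (simp_all add: hpair_def add.assoc)
qed

lemma disjoint_merges_horizontal:
  "disjoint_merges (annotations t) (image_mset fst (annotations (horizontal t)))"
proof (induction t rule: aux_tree_induct)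
  case (Aux es)
  let ?es = "map (map_prod id horizontal) es"
  have "disjoint_merges (image_mset fst (mset es) + (\<Sum>p\<leftarrow>es. annotations (snd p)))
    (image_mset (\<lambda>p. fst (fst p)) (mset (hmerge ?es))
      + (\<Sum>p\<leftarrow>es. image_mset fst (annotations (horizontal (snd p)))))"
  proof (rule disjoint_merges_union)
    show "disjoint_merges (image_mset fst (mset es))
        (image_mset (\<lambda>p. fst (fst p)) (mset (hmerge ?es)))"
      using disjoint_merges_hmerge[of ?es] by (simp add: multiset.map_comp comp_def)
  qed (use Aux.IH in \<open>intro disjoint_merges_sum_list\<close>)
  moreover have "(\<Sum>p\<leftarrow>hmerge ?es. image_mset fst (annotations (snd p))) =
     (\<Sum>p\<leftarrow>es. image_mset fst (annotations (horizontal (snd p))))"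
    by (simp add: sum_list_snd_hmerge[where f = "\<lambda>t. image_mset fst (annotations t)"] comp_def)
  ultimately show ?case
    by (simp add: annotations_Aux_eq_add multiset.map_comp comp_def image_mset_sum_list
        del: annotations.simps)
qed

text \<open>An edge that was merged in Step 1 stands for two edges of \<open>T\<^sub>j\<close>.\<close>

definition num_source_edges :: "('c \<times> bool) aux_tree \<Rightarrow> nat" where
  "num_source_edges t = (\<Sum>e\<in>#annotations t. if snd e then 2 else 1)"

lemma num_source_edges_Aux [simp]:
  "num_source_edges (Aux es) =
    (\<Sum>p\<leftarrow>es. (if snd (fst p) then 2 else 1) + num_source_edges (snd p))"
  unfolding num_source_edges_def by (induction es) auto

lemma num_source_edges_leaf: "is_leaf t \<Longrightarrow> num_source_edges t = 0"
  by (cases t) simp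

lemma num_source_edges_hmerge:
  "num_source_edges (Aux (hmerge es)) = length es + (\<Sum>p\<leftarrow>es. num_source_edges (snd p))"
proof -
  have "(\<Sum>p\<leftarrow>hmerge es. if snd (fst p) then 2 else 1) = length es"
    by (induction es rule: hmerge.induct) (simp_all add: hpair_def snd_fst_hmerge_edges)
  then show ?thesis
    by (simp add: sum_list_addf sum_list_snd_hmerge num_source_edges_leaf)
qed

lemma num_source_edges_horizontal: "num_source_edges (horizontal t) = num_edges t"
proof (induction t rule: aux_tree_induct)
  case (Aux es)
  then have "(\<Sum>p\<leftarrow>es. num_source_edges (horizontal (snd p))) = (\<Sum>p\<leftarrow>es. num_edges (snd p))"
    by (simp cong: map_cong)
  moreover have "num_edges (Aux es) = length es + (\<Sum>p\<leftarrow>es. num_edges (snd p))"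
    by (induction es) auto
  ultimately show ?case
    by (simp add: num_source_edges_hmerge comp_def del: num_source_edges_Aux annotations.simps)
qed

text \<open>Step 1 leaves at most one leaf child of a branching node unmerged, and that one only next to a
  merged edge; hence the factor \<open>2\<close>.\<close>

inductive leaves_charged :: "('c \<times> bool) aux_tree \<Rightarrow> bool" where
  leaves_chargedI:
  "length es = 1 \<or>
    length (filter (\<lambda>p. is_leaf (snd p)) es) \<le> 2 * length (filter (\<lambda>p. snd (fst p)) es) \<Longrightarrow>
   (\<And>p. p \<in> set es \<Longrightarrow> leaves_charged (snd p)) \<Longrightarrow> leaves_charged (Aux es)"

lemma hmerge_leaves_charged:
  "length es \<noteq> 1 \<Longrightarrow> length (filter (\<lambda>p. is_leaf (snd p)) (hmerge es))
    \<le> 2 * length (filter (\<lambda>p. snd (fst p)) (hmerge es))"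
  by (induction es rule: hmerge.induct)
     (auto simp: hpair_def snd_fst_hmerge_edges simp del: hmerge_edges.simps)

lemma hmerge_children:
  assumes "\<And>p. p \<in> set es \<Longrightarrow> P (snd p)" "q \<in> set (hmerge es)"
  shows "P (snd q)"
proof -
  have "P (snd (hmerge_edges p q))" if "P (snd p)" "P (snd q)" for p q :: "'a cluster \<times> 'b aux_tree"
    using that by (cases p; cases q) simp
  then have "(\<forall>p\<in>set es. P (snd p)) \<longrightarrow> (\<forall>q\<in>set (hmerge es). P (snd q))"
    by (induction es rule: hmerge.induct) (auto simp: hpair_def simp del: hmerge_edges.simps)
  with assms show ?thesis by blast
qed

lemma leaves_charged_horizontal: "leaves_charged (horizontal t)"
proof (induction t rule: aux_tree_induct)
  case (Aux es)
  let ?es = "map (map_prod id horizontal) es"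
  have "leaves_charged (Aux (hmerge ?es))"
  proof (rule leaves_chargedI)
    show "length (hmerge ?es) = 1 \<or> length (filter (\<lambda>p. is_leaf (snd p)) (hmerge ?es))
        \<le> 2 * length (filter (\<lambda>p. snd (fst p)) (hmerge ?es))"
    proof (cases "length es = 1")
      case True
      then show ?thesis by (auto simp: length_Suc_conv)
    next
      case False
      then show ?thesis using hmerge_leaves_charged[of ?es] by simp
    qed
    show "leaves_charged (snd p)" if "p \<in> set (hmerge ?es)" for p
      by (rule hmerge_children[OF _ that]) (use Aux.IH in auto)
  qed
  then show ?case by simp
qed

section \<open>Vertical merges\<close>

lemma length_vpairs: "length (vpairs lf cs) = (length cs + 1) div 2"
  by (induction lf cs rule: vpairs.induct) auto

lemma length_vmerge:
  "length (vmerge lf (c, merged) cs) =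
    (if merged \<and> odd (length cs) then 2 else 1) + length cs div 2"
  by (cases cs) (auto simp: length_vpairs elim!: oddE evenE)

lemma vmerge_not_Nil: "vmerge lf e cs \<noteq> []"
  using length_vmerge[of lf "fst e" "snd e" cs] by (auto simp del: vmerge.simps split: if_splits)

lemma disjoint_merges_vpairs: "disjoint_merges (mset cs) (mset (vpairs lf cs))"
  by (induction lf cs rule: vpairs.induct) (auto intro: disjoint_merges.intros)

lemma disjoint_merges_vmerge: "disjoint_merges (add_mset (fst e) (mset cs)) (mset (vmerge lf e cs))"
  using disjoint_merges_vpairs[of cs lf] disjoint_merges_vpairs[of "tl cs" lf]
    disjoint_merges_vpairs[of "fst e # cs" lf]
  by (cases e; cases cs) (auto intro: disjoint_merges.intros)

lemma annotations_path_below: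
  "path_below t = (cs, b) \<Longrightarrow>
    annotations t = image_mset (\<lambda>c. (c, False)) (mset cs) + annotations b"
  by (induction t arbitrary: cs b rule: path_below.induct) (auto split: prod.splits)

lemma leaves_charged_path_below:
  "path_below t = (cs, b) \<Longrightarrow> leaves_charged t \<Longrightarrow> leaves_charged b"
  by (induction t arbitrary: cs b rule: path_below.induct)
     (auto split: prod.splits elim: leaves_charged.cases)

lemma path_below_bottom: "path_below t = (cs, b) \<Longrightarrow> path_below b = ([], b)"
  by (induction t arbitrary: cs b rule: path_below.induct) (auto split: prod.splits)

lemma path_below_NilD: "path_below t = ([], b) \<Longrightarrow> b = t"
  by (induction t rule: path_below.induct) (auto split: prod.splits)

lemma path_induct [case_names Aux]:
  assumes "\<And>es. (\<And>p cs b. p \<in> set es \<Longrightarrow> path_below (snd p) = (cs, b) \<Longrightarrow> P b) \<Longrightarrow> P (Aux es)"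
  shows "P t"
proof (induction t rule: measure_induct_rule[where f = size])
  case (less t)
  show ?case
  proof (cases t)
    case (Aux es)
    have "P b" if "p \<in> set es" "path_below (snd p) = (cs, b)" for p cs b
      using size_snd_less[OF that(1)] size_path_below[OF that(2)] by (intro less) (simp add: Aux)
    then show ?thesis unfolding Aux by (rule assms)
  qed
qed

definition vertical_edge ::
  "('a cluster \<times> bool) \<times> ('a cluster \<times> bool) aux_tree \<Rightarrow> 'a cluster \<times> 'a cluster aux_tree" where
  "vertical_edge = (\<lambda>(e, t). case path_below t of (cs, b) \<Rightarrow>
     (case vmerge (is_leaf b) e cs of d # ds \<Rightarrow> (d, build_path ds (vertical b))))"

lemma vertical_Aux: "vertical (Aux es) = Aux (map vertical_edge es)"
  by (simp add: vertical_edge_def)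

declare vertical.simps [simp del]

lemma is_leaf_vertical [simp]: "is_leaf (vertical t) \<longleftrightarrow> is_leaf t"
  by (cases t) (simp add: vertical_Aux)

lemma annotations_build_path: "annotations (build_path cs b) = mset cs + annotations b"
  by (induction cs) auto

lemma annotations_vertical_edge:
  assumes "path_below t = (cs, b)"
  shows "annotations (Aux [vertical_edge (e, t)]) =
    mset (vmerge (is_leaf b) e cs) + annotations (vertical b)"
  using vmerge_not_Nil[of "is_leaf b" e cs]
  by (auto simp: vertical_edge_def assms annotations_build_path
      split: list.splits simp del: vmerge.simps)

lemma disjoint_merges_vertical:
  "disjoint_merges (image_mset fst (annotations t)) (annotations (vertical t))"
proof (induction t rule: path_induct)
  case (Aux es)
  have "disjoint_merges (image_mset fst (annotations (Aux [p])))
      (annotations (Aux [vertical_edge p]))"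
    if p: "p \<in> set es" for p
  proof -
    obtain e t cs b where path: "p = (e, t)" "path_below t = (cs, b)" by (metis surj_pair)
    have "disjoint_merges (add_mset (fst e) (mset cs) + image_mset fst (annotations b))
        (mset (vmerge (is_leaf b) e cs) + annotations (vertical b))"
      using Aux.IH[OF p] path by (intro disjoint_merges_union disjoint_merges_vmerge) auto
    then show ?thesis
      unfolding path(1) annotations_vertical_edge[OF path(2)]
      by (simp add: annotations_path_below[OF path(2)] multiset.map_comp comp_def del: vmerge.simps)
  qed
  from disjoint_merges_sum_list[OF this] show ?case
    by (simp add: vertical_Aux image_mset_sum_list comp_def)
qed

lemma length_vmerge_le:
  assumes "merged \<or> cs \<noteq> []"
  shows "9 * length (vmerge lf (c, merged) cs) + 6 \<le> 8 * (length cs + (if merged then 2 else 1))"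
proof (cases "even (length cs)")
  case True
  then obtain k where k: "length cs = 2 * k" by (elim evenE)
  then have "merged \<or> k \<ge> 1" using assms by (cases k) auto
  with k show ?thesis by (auto simp: length_vmerge simp del: vmerge.simps)
next
  case False
  then obtain k where "length cs = 2 * k + 1" by (elim oddE)
  then show ?thesis by (simp add: length_vmerge del: vmerge.simps)
qed

text \<open>The weights let the merged edges of a branching node pay for its leaf children: being charged
  for two of them costs a merged edge \<open>4\<close> of its \<open>5\<close> units.\<close>

definition shrinking_edge :: "('a cluster \<times> bool) \<times> ('a cluster \<times> bool) aux_tree \<Rightarrow> bool" where
  "shrinking_edge p \<longleftrightarrow>
    9 * num_edges (Aux [vertical_edge p]) + 1 + 5 * of_bool (snd (fst p))
      \<le> 8 * num_source_edges (Aux [p]) + 2 * of_bool (is_leaf (snd p))"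

lemma shrinking_edge_path:
  assumes path: "path_below t = (cs, b)"
    and bottom: "\<not> is_leaf b \<Longrightarrow> 9 * num_edges (vertical b) + 2 \<le> 8 * num_source_edges b"
  shows "shrinking_edge (e, t)"
proof -
  have source: "num_source_edges t = length cs + num_source_edges b"
    by (simp add: num_source_edges_def annotations_path_below[OF path] multiset.map_comp comp_def)
  have below: "9 * num_edges (vertical b) + 2 * of_bool (\<not> is_leaf b) \<le> 8 * num_source_edges b"
    using bottom by (cases "is_leaf b") (simp_all add: num_source_edges_leaf)
  show ?thesis
  proof (cases "snd e \<or> cs \<noteq> []")
    case True
    then have "9 * length (vmerge (is_leaf b) e cs) + 6
        \<le> 8 * (length cs + (if snd e then 2 else 1))"
      using length_vmerge_le[of "snd e" cs _ "fst e"] by simp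
    then show ?thesis
      using below unfolding shrinking_edge_def annotations_vertical_edge[OF path]
      by (cases "snd e"; cases "cs = []")
         (auto simp: source path_below_NilD simp del: annotations.simps vmerge.simps)
  next
    case False
    then have "b = t" using path path_below_NilD by blast
    with False below show ?thesis
      unfolding shrinking_edge_def annotations_vertical_edge[OF path] by (cases e) auto
  qed
qed

lemma num_edges_vertical_Aux:
  assumes "\<And>p. p \<in> set es \<Longrightarrow> shrinking_edge p"
  shows "9 * num_edges (vertical (Aux es)) + length es + 5 * length (filter (\<lambda>p. snd (fst p)) es)
    \<le> 8 * num_source_edges (Aux es) + 2 * length (filter (\<lambda>p. is_leaf (snd p)) es)"
  using assms by (induction es) (fastforce simp: vertical_Aux shrinking_edge_def)+

lemma num_edges_vertical_branching:
  assumes "leaves_charged t" "\<not> is_leaf t" "path_below t = ([], t)"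
  shows "9 * num_edges (vertical t) + 2 \<le> 8 * num_source_edges t"
  using assms
proof (induction t rule: path_induct)
  case (Aux es)
  let ?leaves = "length (filter (\<lambda>p. is_leaf (snd p)) es)"
  let ?merged = "length (filter (\<lambda>p. snd (fst p)) es)"
  have charged: "length es = 1 \<or> ?leaves \<le> 2 * ?merged"
    and charged_children: "\<And>p. p \<in> set es \<Longrightarrow> leaves_charged (snd p)"
    using Aux.prems(1) by (auto elim: leaves_charged.cases)
  have "shrinking_edge p" if p: "p \<in> set es" for p
  proof -
    obtain e t cs b where path: "p = (e, t)" "path_below t = (cs, b)" by (metis surj_pair)
    have "leaves_charged b"
      using path charged_children[OF p] leaves_charged_path_below by fastforce
    then show ?thesis
      using Aux.IH[OF p] path path_below_bottom[OF path(2)] shrinking_edge_path[OF path(2)] by simp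
  qed
  then have children: "9 * num_edges (vertical (Aux es)) + length es + 5 * ?merged
      \<le> 8 * num_source_edges (Aux es) + 2 * ?leaves"
    by (rule num_edges_vertical_Aux)
  show ?case
  proof (cases "length es = 1")
    case True
    then obtain e t where es_eq: "es = [(e, t)]" by (auto simp: length_Suc_conv)
    with Aux.prems(3) have "snd e" by (cases e; cases "snd e") (auto split: prod.splits)
    with es_eq have "?merged = 1" "?leaves \<le> 1" by simp_all
    with children True show ?thesis by linarith
  next
    case False
    with Aux.prems(2) have "length es \<ge> 2" by (cases es; cases "tl es") auto
    with children charged False show ?thesis by linarith
  qed
qed

lemma num_edges_vertical:
  assumes "leaves_charged t" "\<not> is_leaf t" "\<And>c. t \<noteq> Aux [((c, False), Aux [])]"
  shows "9 * num_edges (vertical t) + 1 \<le> 8 * num_source_edges t"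
proof (cases "path_below t = ([], t)")
  case True
  then show ?thesis using num_edges_vertical_branching assms by fastforce
next
  case False
  then obtain c u where t_eq: "t = Aux [((c, False), u)]"
    by (cases t rule: path_below.cases) auto
  with assms(3) have "\<not> is_leaf u" by (cases u) auto
  obtain cs b where path: "path_below u = (cs, b)" by fastforce
  have "leaves_charged u" using assms(1) by (auto simp: t_eq elim: leaves_charged.cases)
  then have "leaves_charged b" using leaves_charged_path_below[OF path] by blast
  then have "9 * num_edges (vertical b) + 2 \<le> 8 * num_source_edges b" if "\<not> is_leaf b"
    using that path_below_bottom[OF path] num_edges_vertical_branching by blast
  from shrinking_edge_path[OF path this, of "(c, False)"] \<open>\<not> is_leaf u\<close> show ?thesis
    by (simp add: t_eq vertical_Aux shrinking_edge_def)
qed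

section \<open>Iterations\<close>

lemma is_leaf_iteration [simp]: "is_leaf (iteration t) \<longleftrightarrow> is_leaf t"
  by (simp add: iteration_def)

lemma num_edges_iteration:
  assumes "\<not> is_leaf t" "\<not> single_edge t"
  shows "9 * num_edges (iteration t) < 8 * num_edges t"
proof -
  have "horizontal t \<noteq> Aux [((c, False), Aux [])]" for c
  proof
    assume "horizontal t = Aux [((c, False), Aux [])]"
    then have "num_edges t = 1" using num_source_edges_horizontal[of t] by simp
    then show False using single_edge_if_num_edges_eq_1 assms(2) by blast
  qed
  then have "9 * num_edges (vertical (horizontal t)) + 1 \<le> 8 * num_source_edges (horizontal t)"
    using assms(1) by (intro num_edges_vertical leaves_charged_horizontal) simp_all
  then show ?thesis by (simp add: iteration_def num_source_edges_horizontal)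
qed

lemma sum_num_leaves_iteration:
  "(\<Sum>c\<in>#annotations (iteration t). num_leaves c) = (\<Sum>c\<in>#annotations t. num_leaves c)"
  unfolding iteration_def
  using disjoint_merges_horizontal[of t] disjoint_merges_vertical[of "horizontal t"]
  by (metis sum_num_leaves_disjoint_merges)

lemma set_cluster_iteration:
  "(\<Union>c\<in>set_mset (annotations (iteration t)). set_cluster c) =
    (\<Union>c\<in>set_mset (annotations t). set_cluster c)"
  unfolding iteration_def
  using disjoint_merges_horizontal[of t] disjoint_merges_vertical[of "horizontal t"]
  by (metis set_cluster_disjoint_merges)

definition stage :: "'a otree \<Rightarrow> nat \<Rightarrow> 'a cluster aux_tree" where
  "stage T j = (iteration ^^ j) (initial T)"

lemma stage_0 [simp]: "stage T 0 = initial T"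
  and stage_Suc [simp]: "stage T (Suc j) = iteration (stage T j)"
  by (simp_all add: stage_def)

lemma sum_num_leaves_stage: "Suc (\<Sum>c\<in>#annotations (stage T j). num_leaves c) = num_nodes T"
proof (induction j)
  case 0
  have "(\<Sum>c\<in>#add_mset (CLeaf (label T)) (annotations (initial T)). num_leaves c) = num_nodes T"
    by (simp only: annotations_initial) (simp add: multiset.map_comp comp_def size_node_labels)
  then show ?case by simp
qed (simp add: sum_num_leaves_iteration)

lemma set_cluster_stage: "(\<Union>c\<in>set_mset (annotations (stage T j)). set_cluster c) \<subseteq> set_otree T"
proof (induction j)
  case 0
  have "(\<Union>c\<in>set_mset (add_mset (CLeaf (label T)) (annotations (initial T))). set_cluster c)
      = set_otree T"
    by (simp only: annotations_initial) (simp add: set_node_labels)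
  then show ?case by auto
qed (simp add: set_cluster_iteration)

lemma Suc_num_edges_initial: "Suc (num_edges (initial T)) = num_nodes T"
  using arg_cong[OF annotations_initial, of size T] by (simp add: size_node_labels)

lemma is_leaf_stage [simp]: "is_leaf (stage T j) \<longleftrightarrow> num_nodes T = 1"
proof (induction j)
  case 0
  then show ?case using Suc_num_edges_initial[of T] by (auto simp flip: annotations_eq_empty)
qed simp

lemma num_edges_stage_le:
  assumes "num_nodes T \<ge> 2" "\<And>i. i < j \<Longrightarrow> \<not> single_edge (stage T i)"
  shows "real (num_edges (stage T j)) \<le> num_nodes T * (8 / 9) ^ j"
  using assms(2)
proof (induction j)
  case 0
  then show ?case using Suc_num_edges_initial[of T] by simp
next
  case (Suc j)
  have "9 * num_edges (stage T (Suc j)) < 8 * num_edges (stage T j)"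
    using num_edges_iteration[of "stage T j"] assms(1) Suc.prems by simp
  then have "9 * real (num_edges (stage T (Suc j))) \<le> 8 * real (num_edges (stage T j))"
    by linarith
  also have "\<dots> \<le> 8 * (num_nodes T * (8 / 9) ^ j)" using Suc by simp
  finally show ?case by simp
qed

lemma top_tree_eq:
  assumes "num_nodes T \<ge> 2"
  obtains J c where "stage T J = Aux [(c, Aux [])]" "top_tree T = CMerge MA (CLeaf (label T)) c"
    and "\<And>j. j < J \<Longrightarrow> \<not> single_edge (stage T j)"
proof -
  define J where "J = (LEAST j. single_edge (stage T j))"
  have "\<exists>t. while_option (\<lambda>t. \<not> single_edge t) iteration (initial T) = Some t"
  proof (rule measure_while_option_Some[where P = "\<lambda>t. \<not> is_leaf t" and f = num_edges])
    fix t :: "'a cluster aux_tree"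
    assume "\<not> is_leaf t" "\<not> single_edge t"
    then show "\<not> is_leaf (iteration t) \<and> num_edges (iteration t) < num_edges t"
      using num_edges_iteration[of t] by simp
  next
    show "\<not> is_leaf (initial T)" using is_leaf_stage[of T 0] assms by simp
  qed
  then have while_eq: "while_option (\<lambda>t. \<not> single_edge t) iteration (initial T) = Some (stage T J)"
    by (auto simp: while_option_def J_def stage_def split: if_splits)
  then obtain c where "stage T J = Aux [(c, Aux [])]"
    using while_option_stop by (fastforce simp: single_edge_def)
  moreover have "\<not> single_edge (stage T j)" if "j < J" for j
    using that not_less_Least unfolding J_def by blast
  ultimately show ?thesis
    using that by (simp add: top_tree_def while_def while_eq)
qed

section \<open>Small clusters\<close>

fun preorder :: "'a cluster \<Rightarrow> (merge_type + 'a) list" where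
  "preorder (CLeaf a) = [Inr a]"
| "preorder (CMerge m l r) = Inl m # preorder l @ preorder r"

lemma preorder_prefix_free: "preorder c @ xs = preorder d @ ys \<Longrightarrow> c = d \<and> xs = ys"
proof (induction c arbitrary: d xs ys)
  case (CLeaf a)
  then show ?case by (cases d) auto
next
  case (CMerge m l r)
  from CMerge.prems obtain l' r' where d: "d = CMerge m l' r'"
    and "preorder l @ preorder r @ xs = preorder l' @ preorder r' @ ys"
    by (cases d) auto
  then have "l = l'" "preorder r @ xs = preorder r' @ ys" by (metis CMerge.IH(1))+
  then show ?case using CMerge.IH(2) d by simp
qed

lemma length_preorder: "Suc (length (preorder c)) = 2 * num_leaves c"
  by (induction c) auto

lemma set_preorder: "set (preorder c) \<subseteq> UNIV <+> set_cluster c"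
  by (induction c) auto

lemma UNIV_merge_type: "UNIV = {MA, MB, MC, MD, ME}"
  using merge_type.exhaust by auto

definition small :: "nat \<Rightarrow> 'a set \<Rightarrow> 'a cluster set" where
  "small s \<Sigma> = {c. set_cluster c \<subseteq> \<Sigma> \<and> num_leaves c \<le> s}"

lemma preorder_small:
  "preorder ` small s \<Sigma> \<subseteq> {xs. set xs \<subseteq> UNIV <+> \<Sigma> \<and> length xs < 2 * s}"
proof (intro image_subsetI CollectI conjI)
  fix c assume "c \<in> small s \<Sigma>"
  then show "set (preorder c) \<subseteq> UNIV <+> \<Sigma>" "length (preorder c) < 2 * s"
    using set_preorder[of c] length_preorder[of c] by (auto simp: small_def)
qed

lemma finite_UNIV_merge_type: "finite (UNIV :: merge_type set)"
  by (simp add: UNIV_merge_type)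

lemma inj_on_preorder: "inj_on preorder X"
  using preorder_prefix_free[of _ "[]" _ "[]"] by (auto intro: inj_onI)

lemma finite_small:
  assumes "finite \<Sigma>"
  shows "finite (small s \<Sigma>)"
proof (rule finite_imageD)
  show "finite (preorder ` small s \<Sigma>)"
    using finite_UNIV_merge_type assms
    by (intro finite_subset[OF preorder_small] finite_lists_length_less finite_Plus)
qed (rule inj_on_preorder)

lemma card_small_le:
  assumes "finite \<Sigma>" "card \<Sigma> \<ge> 2"
  shows "card (small s \<Sigma>) \<le> card \<Sigma> ^ (6 * s)"
proof -
  let ?A = "(UNIV :: merge_type set) <+> \<Sigma>"
  have "finite ?A" using finite_UNIV_merge_type assms(1) by (rule finite_Plus)
  have "card ?A = card (UNIV :: merge_type set) + card \<Sigma>"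
    using finite_UNIV_merge_type assms(1) by (rule card_Plus)
  also have "\<dots> = 5 + card \<Sigma>" by (simp add: UNIV_merge_type)
  finally have "card ?A = 5 + card \<Sigma>" .
  moreover have "2 * 2 * card \<Sigma> \<le> card \<Sigma> * card \<Sigma> * card \<Sigma>"
    using assms(2) by (intro mult_mono) auto
  ultimately have "card ?A \<le> card \<Sigma> ^ 3"
    unfolding power3_eq_cube using assms(2) by linarith
  have "card (small s \<Sigma>) \<le> card {xs. set xs \<subseteq> ?A \<and> length xs < 2 * s}"
    using inj_on_preorder preorder_small finite_lists_length_less[OF \<open>finite ?A\<close>]
    by (rule card_inj_on_le)
  also have "\<dots> \<le> card ?A ^ (2 * s)"
    using \<open>finite ?A\<close> \<open>card ?A = 5 + card \<Sigma>\<close> by (intro card_lists_length_less_le) simp_all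
  also have "\<dots> \<le> (card \<Sigma> ^ 3) ^ (2 * s)" using \<open>card ?A \<le> card \<Sigma> ^ 3\<close> by (rule power_mono) simp
  also have "\<dots> = card \<Sigma> ^ (6 * s)" by (simp flip: power_mult)
  finally show ?thesis .
qed

section \<open>Large clusters\<close>

definition large :: "nat \<Rightarrow> 'a cluster set \<Rightarrow> 'a cluster set" where
  "large s X = {c \<in> X. s < num_leaves c}"

lemma card_large_le_min:
  assumes "(\<Sum>c\<in>#A. num_leaves c) \<le> N" "size A \<le> k"
  shows "real (card (large s (set_mset A))) \<le> min (real N / (real s + 1)) (real k)"
proof -
  have "card (large s (set_mset A)) * Suc s \<le> N"
    unfolding large_def using card_greater_mult_le_sum_mset assms(1) by (rule order.trans)
  then have "real (card (large s (set_mset A)) * Suc s) \<le> real N" by (simp only: of_nat_le_iff)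
  moreover have "card (large s (set_mset A)) \<le> card (set_mset A)"
    unfolding large_def by (intro card_mono) auto
  then have "card (large s (set_mset A)) \<le> k"
    using card_set_mset_le_size[of A] assms(2) by linarith
  ultimately show ?thesis by (simp add: field_simps)
qed

lemma finite_subtrees [simp]: "finite (subtrees c)"
  by (induction c) auto

lemma finite_subclusters [simp]: "finite (subclusters A)"
  by (simp add: subclusters_def)

lemma card_large_Un: "card (large s (X \<union> Y)) \<le> card (large s X) + card (large s Y)"
proof -
  have "large s (X \<union> Y) = large s X \<union> large s Y" by (auto simp: large_def)
  then show ?thesis by (simp add: card_Un_le)
qed

lemma card_large_subclusters_disjoint_merges:
  assumes "disjoint_merges A B"
  shows "card (large s (subclusters B))
    \<le> card (large s (set_mset B)) + card (large s (subclusters A))"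
proof -
  have "card (large s (subclusters B)) \<le> card (large s (set_mset B \<union> subclusters A))"
    using subclusters_disjoint_merges[OF assms] by (intro card_mono) (auto simp: large_def)
  also have "\<dots> \<le> card (large s (set_mset B)) + card (large s (subclusters A))"
    by (rule card_large_Un)
  finally show ?thesis .
qed

lemma card_large_subclusters_iteration:
  assumes "(\<Sum>c\<in>#annotations t. num_leaves c) \<le> N"
  shows "real (card (large s (subclusters (annotations (iteration t)))))
    \<le> real (card (large s (subclusters (annotations t))))
      + 2 * min (real N / (real s + 1)) (real (num_edges t))"
proof -
  let ?step1 = "image_mset fst (annotations (horizontal t))"
  let ?step2 = "annotations (iteration t)"
  let ?bound = "min (real N / (real s + 1)) (real (num_edges t))"
  have step1: "disjoint_merges (annotations t) ?step1" by (rule disjoint_merges_horizontal)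
  have step2: "disjoint_merges ?step1 ?step2"
    unfolding iteration_def by (rule disjoint_merges_vertical)
  have "(\<Sum>c\<in>#?step1. num_leaves c) \<le> N" "(\<Sum>c\<in>#?step2. num_leaves c) \<le> N"
    using assms by (simp_all only: sum_num_leaves_disjoint_merges[OF step1]
        sum_num_leaves_disjoint_merges[OF step2])
  moreover have "size ?step1 \<le> num_edges t" "size ?step2 \<le> num_edges t"
    using size_disjoint_merges_le[OF step1] size_disjoint_merges_le[OF step2] by simp_all
  ultimately have "real (card (large s (set_mset ?step1))) \<le> ?bound"
    "real (card (large s (set_mset ?step2))) \<le> ?bound"
    by (blast intro: card_large_le_min)+
  then show ?thesis
    using card_large_subclusters_disjoint_merges[OF step1, of s]
      card_large_subclusters_disjoint_merges[OF step2, of s]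
    by linarith
qed

lemma subclusters_annotations_initial:
  "subclusters (annotations (initial T)) = set_mset (annotations (initial T))"
proof -
  have "subtrees c = {c}" if "c \<in># annotations (initial T)" for c
  proof -
    from that have "c \<in># image_mset CLeaf (node_labels T)"
      by (simp flip: annotations_initial)
    then show ?thesis by auto
  qed
  then show ?thesis by (auto simp: subclusters_def)
qed

lemma card_large_subclusters_stage:
  assumes "num_nodes T \<ge> 2" "\<And>i. i < j \<Longrightarrow> \<not> single_edge (stage T i)"
  shows "real (card (large s (subclusters (annotations (stage T j)))))
    \<le> num_nodes T * (1 / (real s + 1) + 2 * (\<Sum>i<j. min (1 / (real s + 1)) ((8 / 9) ^ i)))"
  using assms(2)
proof (induction j)
  case 0
  have "real (card (large s (set_mset (annotations (initial T)))))
      \<le> min (num_nodes T / (real s + 1)) (real (num_nodes T))"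
    using sum_num_leaves_stage[of T 0] Suc_num_edges_initial[of T]
    by (intro card_large_le_min) simp_all
  then show ?case by (simp add: subclusters_annotations_initial)
next
  case (Suc j)
  let ?n = "real (num_nodes T)"
  have "real (card (large s (subclusters (annotations (stage T (Suc j))))))
      \<le> real (card (large s (subclusters (annotations (stage T j)))))
        + 2 * min (?n / (real s + 1)) (real (num_edges (stage T j)))"
    using sum_num_leaves_stage[of T j]
    unfolding stage_Suc by (intro card_large_subclusters_iteration) linarith
  also have "min (?n / (real s + 1)) (real (num_edges (stage T j)))
      \<le> min (?n * (1 / (real s + 1))) (?n * (8 / 9) ^ j)"
    using num_edges_stage_le[OF assms(1), of j] Suc.prems by (intro min.mono) simp_all
  also have "\<dots> = ?n * min (1 / (real s + 1)) ((8 / 9) ^ j)"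
    by (simp add: min_mult_distrib_left)
  finally show ?case using Suc by (simp add: algebra_simps)
qed

section \<open>The size of the top DAG\<close>

lemma top_dag_size_le: "top_dag_size T \<le> 3 * card (subtrees (top_tree T))"
proof -
  let ?S = "subtrees (top_tree T)"
  let ?left = "\<lambda>c. (c, False, case c of CMerge m l r \<Rightarrow> l | _ \<Rightarrow> c)"
  let ?right = "\<lambda>c. (c, True, case c of CMerge m l r \<Rightarrow> r | _ \<Rightarrow> c)"
  have "dag_edges (top_tree T) \<subseteq> ?left ` ?S \<union> ?right ` ?S"
    unfolding dag_edges_def by force
  then have "card (dag_edges (top_tree T)) \<le> card (?left ` ?S \<union> ?right ` ?S)"
    by (intro card_mono) auto
  also have "\<dots> \<le> card ?S + card ?S"
    by (intro order.trans[OF card_Un_le] add_mono card_image_le) auto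
  finally show ?thesis by (simp add: top_dag_size_def dag_nodes_def)
qed

lemma set_cluster_subtrees: "c \<in> subtrees d \<Longrightarrow> set_cluster c \<subseteq> set_cluster d"
  by (induction d) auto

lemma card_subtrees_top_tree_le:
  assumes alphabet: "finite \<Sigma>" "card \<Sigma> \<ge> 2" "set_otree T \<subseteq> \<Sigma>" and nodes: "num_nodes T \<ge> 2"
  shows "real (card (subtrees (top_tree T))) \<le> 2 + real (card \<Sigma>) ^ (6 * s) +
    num_nodes T * ((2 * real K + 1) / (real s + 1) + 18 * (8 / 9) ^ K)"
proof -
  obtain J c where stage_J: "stage T J = Aux [(c, Aux [])]"
    and top: "top_tree T = CMerge MA (CLeaf (label T)) c"
    and before_J: "\<And>j. j < J \<Longrightarrow> \<not> single_edge (stage T j)"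
    using top_tree_eq[OF nodes] by blast
  let ?ends = "{top_tree T, CLeaf (label T)}"
  let ?large = "large s (subtrees c)"
  let ?a = "1 / (real s + 1)"
  have "set_cluster c \<subseteq> \<Sigma>" using set_cluster_stage[of T J] alphabet(3) by (simp add: stage_J)
  then have "subtrees (top_tree T) \<subseteq> ?ends \<union> (small s \<Sigma> \<union> ?large)"
    using set_cluster_subtrees[of _ c] by (fastforce simp: top small_def large_def)
  then have "card (subtrees (top_tree T)) \<le> card (?ends \<union> (small s \<Sigma> \<union> ?large))"
    using finite_small[OF alphabet(1)] by (intro card_mono) (simp_all add: large_def)
  also have "\<dots> \<le> card ?ends + (card (small s \<Sigma>) + card ?large)"
    using card_Un_le[of ?ends "small s \<Sigma> \<union> ?large"] card_Un_le[of "small s \<Sigma>" ?large] by linarith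
  also have "\<dots> \<le> 2 + (card \<Sigma> ^ (6 * s) + card ?large)"
    using card_small_le[OF alphabet(1,2)] by (intro add_mono) (auto simp: card_insert_if)
  finally have "real (card (subtrees (top_tree T)))
      \<le> 2 + real (card \<Sigma>) ^ (6 * s) + real (card ?large)"
    by (simp flip: of_nat_power of_nat_add)
  also have "real (card ?large) \<le> num_nodes T * (?a + 2 * (\<Sum>i<J. min ?a ((8 / 9) ^ i)))"
    using card_large_subclusters_stage[of T J s, OF nodes before_J]
    by (simp add: stage_J subclusters_def)
  also have "\<dots> \<le> num_nodes T * (?a + 2 * (K * ?a + (8 / 9) ^ K / (1 - 8 / 9)))"
    by (intro mult_left_mono add_left_mono sum_min_power_le) simp_all
  also have "\<dots> = num_nodes T * ((2 * real K + 1) / (real s + 1) + 18 * (8 / 9) ^ K)"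
    by (simp add: algebra_simps add_divide_distrib)
  finally show ?thesis by simp
qed

lemma large_clusters_bound_le:
  fixes L :: real
  assumes "L > 1" "L / 12 \<le> real s + 1" "log (9 / 8) L \<le> real K" "real K \<le> log (9 / 8) L + 1"
  shows "(2 * real K + 1) / (real s + 1) + 18 * (8 / 9) ^ K \<le> (24 * log (9 / 8) L + 54) / L"
proof -
  have "(8 / 9) ^ K \<le> 1 / L" using assms by (intro power_le_inverse) simp_all
  moreover have "(2 * real K + 1) / (real s + 1) \<le> (2 * real K + 1) / (L / 12)"
    using assms by (intro divide_left_mono) simp_all
  ultimately have "(2 * real K + 1) / (real s + 1) + 18 * (8 / 9) ^ K
      \<le> (2 * real K + 1) / (L / 12) + 18 * (1 / L)"
    by linarith
  also have "\<dots> = (24 * real K + 30) / L" using assms(1) by (simp add: field_simps)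
  also have "\<dots> \<le> (24 * log (9 / 8) L + 54) / L" using assms by (intro divide_right_mono) simp_all
  finally show ?thesis .
qed

lemma top_dag_size_le_log:
  fixes \<Sigma> :: "'a set" and T :: "'a otree"
  defines "n \<equiv> real (num_nodes T)"
  defines "L \<equiv> log (real (card \<Sigma>)) n"
  assumes alphabet: "finite \<Sigma>" "card \<Sigma> \<ge> 2" "set_otree T \<subseteq> \<Sigma>" and "L > 1"
  shows "real (top_dag_size T) \<le> (72 * log (9 / 8) L + 198) * (n / L)"
proof -
  define s where "s = nat \<lfloor>L / 12\<rfloor>"
  define K where "K = nat \<lceil>log (9 / 8) L\<rceil>"
  let ?large = "(2 * real K + 1) / (real s + 1) + 18 * (8 / 9) ^ K"
  have "n \<ge> 1" by (cases T) (simp add: n_def)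
  then have "n > real (card \<Sigma>)" using \<open>L > 1\<close> alphabet(2) by (simp add: L_def)
  then have "num_nodes T \<ge> 2" "n > 1" using alphabet(2) by (simp_all add: n_def)
  have s_bounds: "real s \<le> L / 12" "L / 12 \<le> real s + 1" using \<open>L > 1\<close> unfolding s_def by linarith+
  have "log (9 / 8) L > 0" using \<open>L > 1\<close> by simp
  then have K_bounds: "log (9 / 8) L \<le> K" "K \<le> log (9 / 8) L + 1" unfolding K_def by linarith+
  have "real (card \<Sigma>) ^ (6 * s) \<le> sqrt n"
    using s_bounds alphabet(2) \<open>n > 1\<close> by (intro power_le_sqrt) (simp_all add: L_def)
  moreover have "sqrt n \<le> 4 * (n / L)"
    unfolding L_def using alphabet(2) \<open>n > 1\<close> by (intro sqrt_le_div_log) simp_all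
  moreover have "n * ?large \<le> n * ((24 * log (9 / 8) L + 54) / L)"
    using large_clusters_bound_le[OF \<open>L > 1\<close> s_bounds(2) K_bounds] \<open>n > 1\<close>
    by (intro mult_left_mono) simp_all
  moreover have "real (card (subtrees (top_tree T))) \<le> 2 + real (card \<Sigma>) ^ (6 * s) + n * ?large"
    unfolding n_def by (rule card_subtrees_top_tree_le[OF alphabet \<open>num_nodes T \<ge> 2\<close>])
  ultimately have "real (card (subtrees (top_tree T)))
      \<le> 12 * (n / L) + n * ((24 * log (9 / 8) L + 54) / L)"
    using real_sqrt_ge_one[OF \<open>n \<ge> 1\<close>] by linarith
  then have "3 * real (card (subtrees (top_tree T)))
      \<le> 3 * (12 * (n / L) + n * ((24 * log (9 / 8) L + 54) / L))"
    by simp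
  also have "\<dots> = (72 * log (9 / 8) L + 198) * (n / L)" using \<open>L > 1\<close> by (simp add: field_simps)
  finally show ?thesis using top_dag_size_le[of T] by linarith
qed

theorem theorem1:
  fixes b :: real
  assumes "b > 1"
  shows "\<exists>C>0. \<forall>(\<Sigma> :: 'a set) (T :: 'a otree).
    finite \<Sigma> \<longrightarrow> card \<Sigma> \<ge> 2 \<longrightarrow> set_otree T \<subseteq> \<Sigma> \<longrightarrow>
    log (real (card \<Sigma>)) (real (num_nodes T)) \<ge> b \<longrightarrow>
    real (top_dag_size T) \<le>
      C * (real (num_nodes T) / log (real (card \<Sigma>)) (real (num_nodes T))
             * log 2 (log (real (card \<Sigma>)) (real (num_nodes T))))"
proof (intro exI[of _ "72 / log 2 (9 / 8) + 198 / log 2 b"] conjI allI impI)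
  show "72 / log 2 (9 / 8) + 198 / log 2 b > 0" using assms by (simp add: add_pos_pos)
next
  fix \<Sigma> :: "'a set" and T :: "'a otree"
  define n where "n = real (num_nodes T)"
  define L where "L = log (real (card \<Sigma>)) n"
  assume alphabet: "finite \<Sigma>" "card \<Sigma> \<ge> 2" "set_otree T \<subseteq> \<Sigma>"
    and "log (real (card \<Sigma>)) (real (num_nodes T)) \<ge> b"
  then have "L \<ge> b" by (simp add: L_def n_def)
  with assms have "1 \<le> log 2 L / log 2 b" "L > 1" by simp_all
  have "real (top_dag_size T) \<le> (72 * log (9 / 8) L + 198) * (n / L)"
    using top_dag_size_le_log[OF alphabet] \<open>L > 1\<close> by (simp add: n_def L_def)
  also have "\<dots> \<le> (72 * (log 2 L / log 2 (9 / 8)) + 198 * (log 2 L / log 2 b)) * (n / L)"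
    using \<open>1 \<le> log 2 L / log 2 b\<close> \<open>L > 1\<close> log_base_change[of 2 "9 / 8" L]
    by (intro mult_right_mono) (simp_all add: n_def)
  finally show "real (top_dag_size T) \<le> (72 / log 2 (9 / 8) + 198 / log 2 b) *
      (real (num_nodes T) / log (real (card \<Sigma>)) (real (num_nodes T))
        * log 2 (log (real (card \<Sigma>)) (real (num_nodes T))))"
    unfolding L_def n_def by (simp add: algebra_simps)
qed

end
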